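(* Let $\mathbf A=(\theta,w,x)$ be a simple Q-system in $\mathcal C\subset\mathrm{End}_0(N)$, with $x^{(2)}=(x\times1_\theta)x=(1_\theta\times x)x$. A projection $P\in\mathrm{Hom}(\theta,\theta)$ is of the form $P=\bar p\,p$, where $p\in\mathrm{Hom}(\theta,\theta)$ is a projection satisfying $$(1_\theta\times p)x=xp,\qquad pw=(w^*p\times1_\theta)xw,$$ and $\bar p:=(w^*p\times1_\theta)x$ is the associated projection, if and only if $$(w^*P\times1_\theta\times w^*P)\,x^{(2)}=P.$$
   Context: $N$ is an infinite (type III) von Neumann factor on a separable Hilbert space. For homomorphisms (unital $*$-homomorphisms) $\alpha,\beta:N\to M$, $\mathrm{Hom}(\alpha,\beta)=\{t\in M:t\alpha(n)=\beta(n)t\ \forall n\}$. For $t_i\in\mathrm{Hom}(\alpha_i,\beta_i)$ put $t_1\times t_2=t_1\alpha_1(t_2)\in\mathrm{Hom}(\alpha_1\alpha_2,\beta_1\beta_2)$; thus $1_\alpha\times t=\alpha(t)$, $t\times1_\alpha=t$. $\alpha:N\to M$, $\bar\alpha:M\to N$ are conjugate if there are $w\in\mathrm{Hom}(\mathrm{id}_N,\bar\alpha\alpha)$, $\bar w\in\mathrm{Hom}(\mathrm{id}_M,\alpha\bar\alpha)$ with $w^*\bar\alpha(\bar w)=1$, $\alpha(w^* )\bar w=1$; $\dim\alpha$ is the infimum of $d$ over such pairs with $w^*w=d1_N$, $\bar w^*\bar w=d1_M$. $\mathrm{End}_0(N)$ is the C* tensor category of endomorphisms of finite dimension; $\mathcal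 C\subset\mathrm{End}_0(N)$ is a full tensor subcategory closed under direct sums, subobjects and conjugates. A Q-system is a triple $(\theta,w,x)$ with $\theta\in\mathcal C$, $w\in\mathrm{Hom}(\mathrm{id},\theta)$, $x\in\mathrm{Hom}(\theta,\theta^2)$ satisfying $(w^*\times1_\theta)x=(1_\theta\times w^* )x=1_\theta$; $(x\times1_\theta)x=(1_\theta\times x)x$; $(1_\theta\times x^* )(x\times1_\theta)=xx^*=(x^*\times1_\theta)(1_\theta\times x)$; $w^*w=d1$, $x^*x=d1_\theta$ with $d=\sqrt{\dim\theta}$. Its extension $\iota:N\to M$ is the von Neumann algebra $M=\iota(N)v$ (each element uniquely $\iota(n)v$) with $v\iota(n)=\iota(\theta(n))v$, $v^2=\iota(x)v$, $v^*=\iota(w^*x^* )v$, $1_M=\iota(w^* )v$. The Q-system is simple if $M$ is a factor. For $p$ as in the claim, $\bar p$ is again a projection, commutes with $p$, and the pair satisfies $pw=\bar pw$, $(1_\theta\times p)x=xp$, $(\bar p\times1_\theta)x=x\bar p$, $(p\times1_\theta)x=(1_\theta\times\bar p)x$. *)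

theory Defs
  imports "HOL-Analysis.Analysis" "HOL-Library.FuncSet"
begin

section \<open>Complex Hilbert spaces and bounded operators\<close>

class scaleC =
  fixes scaleC :: "complex \<Rightarrow> 'a \<Rightarrow> 'a" (infixr "*\<^sub>C" 75)

text \<open>
  The norm and the topology are those of the underlying real Hilbert space, whose inner
  product is the real part of the complex one; the complex inner product is linear in its
  second argument.
\<close>

class chilbert_space = real_inner + complete_space + scaleC +
  fixes cinner :: "'a \<Rightarrow> 'a \<Rightarrow> complex"
  assumes scaleC_add_right: "c *\<^sub>C (x + y) = c *\<^sub>C x + c *\<^sub>C y"
    and scaleC_add_left: "(b + c) *\<^sub>C x = b *\<^sub>C x + c *\<^sub>C x"
    and scaleC_scaleC: "b *\<^sub>C c *\<^sub>C x = (b * c) *\<^sub>C x"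
    and scaleC_of_real: "of_real r *\<^sub>C x = r *\<^sub>R x"
    and cinner_commute: "cinner x y = cnj (cinner y x)"
    and cinner_add_right: "cinner x (y + z) = cinner x y + cinner x z"
    and cinner_scaleC_right: "cinner x (c *\<^sub>C y) = c * cinner x y"
    and Re_cinner: "Re (cinner x y) = inner x y"

typedef (overloaded) 'h bop =
  "{f :: 'h::chilbert_space \<Rightarrow> 'h. bounded_linear f \<and> (\<forall>c x. f (c *\<^sub>C x) = c *\<^sub>C f x)}"
  morphisms app Bop
  by (rule exI[of _ "\<lambda>x. x"]) (simp add: bounded_linear_ident)

setup_lifting type_definition_bop

lemma scaleC_bounded_linear:
  "bounded_linear (\<lambda>x :: 'h::chilbert_space. c *\<^sub>C x)"
proof (rule bounded_linear_intro)
  fix x y :: 'h and r :: real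
  show "c *\<^sub>C (x + y) = c *\<^sub>C x + c *\<^sub>C y" by (rule scaleC_add_right)
  show "c *\<^sub>C (r *\<^sub>R x) = r *\<^sub>R (c *\<^sub>C x)"
    by (simp flip: scaleC_of_real add: scaleC_scaleC mult.commute)
  have left: "cinner (c *\<^sub>C x) z = cnj c * cinner x z" for z
    by (subst (1 2) cinner_commute) (simp add: cinner_scaleC_right)
  have "cinner (c *\<^sub>C x) (c *\<^sub>C x) = of_real ((norm c)\<^sup>2) * cinner x x"
    by (simp add: left cinner_scaleC_right complex_norm_square mult.assoc mult.left_commute
        del: of_real_power)
  then have "inner (c *\<^sub>C x) (c *\<^sub>C x) = (norm c)\<^sup>2 * inner x x"
    by (simp flip: Re_cinner del: of_real_power)
  then show "norm (c *\<^sub>C x) \<le> norm x * norm c"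
    by (simp add: norm_eq_sqrt_inner real_sqrt_mult)
qed

instantiation bop :: (chilbert_space) "{ring, monoid_mult, scaleC}"
begin

lift_definition zero_bop :: "'a bop" is "\<lambda>_. 0"
  by (metis bounded_linear_zero add_cancel_right_right scaleC_add_right)
lift_definition one_bop :: "'a bop" is "\<lambda>x. x"
  by (simp add: bounded_linear_ident)
lift_definition plus_bop :: "'a bop \<Rightarrow> 'a bop \<Rightarrow> 'a bop" is "\<lambda>f g x. f x + g x"
  by (simp add: bounded_linear_add scaleC_add_right)
lift_definition uminus_bop :: "'a bop \<Rightarrow> 'a bop" is "\<lambda>f x. - f x"
  by (auto simp: bounded_linear_minus)
     (metis add.right_inverse add_eq_0_iff add_cancel_right_right scaleC_add_right)
lift_definition minus_bop :: "'a bop \<Rightarrow> 'a bop \<Rightarrow> 'a bop" is "\<lambda>f g x. f x - g x"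
  by (auto simp: bounded_linear_sub)
     (metis add_diff_cancel_right' diff_add_cancel scaleC_add_right)
lift_definition times_bop :: "'a bop \<Rightarrow> 'a bop \<Rightarrow> 'a bop" is "\<lambda>f g x. f (g x)"
  by (auto intro: bounded_linear_compose)
lift_definition scaleC_bop :: "complex \<Rightarrow> 'a bop \<Rightarrow> 'a bop" is "\<lambda>c f x. c *\<^sub>C f x"
  by (auto intro: bounded_linear_compose[OF scaleC_bounded_linear]
      simp: scaleC_scaleC mult.commute)

instance
  by standard (transfer; auto simp: fun_eq_iff bounded_linear.linear linear_add)+

end

definition adj :: "'h::chilbert_space bop \<Rightarrow> 'h bop" ("_\<^sup>\<dagger>" [1000] 999) where
  "a\<^sup>\<dagger> = (THE b. \<forall>x y. cinner (app b x) y = cinner x (app a y))"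

definition projection :: "'h::chilbert_space bop \<Rightarrow> bool" where
  "projection p \<longleftrightarrow> p\<^sup>\<dagger> = p \<and> p * p = p"


section \<open>Von Neumann algebras and factors\<close>

definition commutant :: "'h::chilbert_space bop set \<Rightarrow> 'h bop set" where
  "commutant S = {b. \<forall>a\<in>S. a * b = b * a}"

definition von_neumann_algebra :: "'h::chilbert_space bop set \<Rightarrow> bool" where
  "von_neumann_algebra N \<longleftrightarrow> (\<forall>a\<in>N. a\<^sup>\<dagger> \<in> N) \<and> commutant (commutant N) = N"

text \<open>The condition \<open>1 \<noteq> 0\<close> excludes the zero algebra on the zero Hilbert space.\<close>

definition factor :: "'h::chilbert_space bop set \<Rightarrow> bool" where
  "factor N \<longleftrightarrow> von_neumann_algebra N \<and> (1 :: 'h bop) \<noteq> 0 \<and>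
    N \<inter> commutant N = range (\<lambda>c. c *\<^sub>C 1)"

text \<open>Murray-von Neumann finiteness: no proper subprojection of \<open>p\<close> is equivalent to \<open>p\<close>.\<close>

definition finite_projection :: "'h::chilbert_space bop set \<Rightarrow> 'h bop \<Rightarrow> bool" where
  "finite_projection N p \<longleftrightarrow> p \<in> N \<and> projection p \<and>
    (\<forall>u\<in>N. u\<^sup>\<dagger> * u = p \<and> p * (u * u\<^sup>\<dagger>) = u * u\<^sup>\<dagger> \<longrightarrow> u * u\<^sup>\<dagger> = p)"

definition type_III :: "'h::chilbert_space bop set \<Rightarrow> bool" where
  "type_III N \<longleftrightarrow> von_neumann_algebra N \<and> (\<forall>p. finite_projection N p \<longrightarrow> p = 0)"


section \<open>Homomorphisms, intertwiners and conjugates\<close>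

text \<open>
  Homomorphisms are extensional functions, so that equality of homomorphisms is equality on
  the algebra; composites are formed with \<open>compose\<close>.
\<close>

definition homs ::
    "'h::chilbert_space bop set \<Rightarrow> 'k::chilbert_space bop set \<Rightarrow> ('h bop \<Rightarrow> 'k bop) set" where
  "homs N M = {\<alpha> \<in> N \<rightarrow>\<^sub>E M. \<alpha> 1 = 1 \<and>
    (\<forall>a\<in>N. \<forall>b\<in>N. \<alpha> (a + b) = \<alpha> a + \<alpha> b \<and> \<alpha> (a * b) = \<alpha> a * \<alpha> b) \<and>
    (\<forall>c. \<forall>a\<in>N. \<alpha> (c *\<^sub>C a) = c *\<^sub>C \<alpha> a) \<and>
    (\<forall>a\<in>N. \<alpha> (a\<^sup>\<dagger>) = (\<alpha> a)\<^sup>\<dagger>)}"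

definition id_hom :: "'h::chilbert_space bop set \<Rightarrow> 'h bop \<Rightarrow> 'h bop" where
  "id_hom N = (\<lambda>n\<in>N. n)"

definition Hom :: "'h::chilbert_space bop set \<Rightarrow> 'k::chilbert_space bop set \<Rightarrow>
    ('h bop \<Rightarrow> 'k bop) \<Rightarrow> ('h bop \<Rightarrow> 'k bop) \<Rightarrow> 'k bop set" where
  "Hom N M \<alpha> \<beta> = {t \<in> M. \<forall>n\<in>N. t * \<alpha> n = \<beta> n * t}"

text \<open>
  In \<open>t\<^sub>1 \<otimes>\<^bsub>\<alpha>\<^esub> t\<^sub>2\<close> the subscript is the source \<open>\<alpha>\<close> of \<open>t\<^sub>1\<close>; the unit intertwiner of every
  endomorphism is the operator \<open>1\<close>.
\<close>

definition hom_times :: "'h::chilbert_space bop \<Rightarrow> ('k::chilbert_space bop \<Rightarrow> 'h bop) \<Rightarrow>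
    'k bop \<Rightarrow> 'h bop" ("_ \<otimes>\<^bsub>_\<^esub> _" [71, 0, 72] 71) where
  "t\<^sub>1 \<otimes>\<^bsub>\<alpha>\<^esub> t\<^sub>2 = t\<^sub>1 * \<alpha> t\<^sub>2"

definition conjugate_by :: "'h::chilbert_space bop set \<Rightarrow> 'k::chilbert_space bop set \<Rightarrow>
    ('h bop \<Rightarrow> 'k bop) \<Rightarrow> ('k bop \<Rightarrow> 'h bop) \<Rightarrow> 'h bop \<Rightarrow> 'k bop \<Rightarrow> bool" where
  "conjugate_by N M \<alpha> \<alpha>' w w' \<longleftrightarrow> \<alpha> \<in> homs N M \<and> \<alpha>' \<in> homs M N \<and>
    w \<in> Hom N N (id_hom N) (compose N \<alpha>' \<alpha>) \<and>
    w' \<in> Hom M M (id_hom M) (compose M \<alpha> \<alpha>') \<and>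
    w\<^sup>\<dagger> * \<alpha>' w' = 1 \<and> \<alpha> (w\<^sup>\<dagger>) * w' = 1"

definition conjugate :: "'h::chilbert_space bop set \<Rightarrow> 'k::chilbert_space bop set \<Rightarrow>
    ('h bop \<Rightarrow> 'k bop) \<Rightarrow> ('k bop \<Rightarrow> 'h bop) \<Rightarrow> bool" where
  "conjugate N M \<alpha> \<alpha>' \<longleftrightarrow> (\<exists>w w'. conjugate_by N M \<alpha> \<alpha>' w w')"

text \<open>Meaningful only if \<open>\<alpha>\<close> has a conjugate, that is, if its dimension is finite.\<close>

definition hom_dim :: "'h::chilbert_space bop set \<Rightarrow> 'k::chilbert_space bop set \<Rightarrow>
    ('h bop \<Rightarrow> 'k bop) \<Rightarrow> real" where
  "hom_dim N M \<alpha> = Inf {d. \<exists>\<alpha>' w w'. conjugate_by N M \<alpha> \<alpha>' w w' \<and>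
    w\<^sup>\<dagger> * w = of_real d *\<^sub>C 1 \<and> w'\<^sup>\<dagger> * w' = of_real d *\<^sub>C 1}"

definition End0 :: "'h::chilbert_space bop set \<Rightarrow> ('h bop \<Rightarrow> 'h bop) set" where
  "End0 N = {\<alpha> \<in> homs N N. \<exists>\<alpha>'. conjugate N N \<alpha> \<alpha>'}"

text \<open>
  A full subcategory is given by its set of objects. Closure under direct sums, subobjects
  and conjugates is understood up to unitary equivalence; a subobject corresponds to a
  nonzero projection, since the zero object is not a unital endomorphism.
\<close>

definition full_tensor_subcategory ::
    "'h::chilbert_space bop set \<Rightarrow> ('h bop \<Rightarrow> 'h bop) set \<Rightarrow> bool" where
  "full_tensor_subcategory N C \<longleftrightarrow> C \<subseteq> End0 N \<and> id_hom N \<in> C \<and>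
    (\<forall>\<alpha>\<in>C. \<forall>\<beta>\<in>C. compose N \<alpha> \<beta> \<in> C) \<and>
    (\<forall>\<alpha>\<in>C. \<forall>\<beta>\<in>C. \<exists>\<gamma>\<in>C. \<exists>s\<in>Hom N N \<alpha> \<gamma>. \<exists>t\<in>Hom N N \<beta> \<gamma>.
      s\<^sup>\<dagger> * s = 1 \<and> t\<^sup>\<dagger> * t = 1 \<and> s * s\<^sup>\<dagger> + t * t\<^sup>\<dagger> = 1) \<and>
    (\<forall>\<beta>\<in>C. \<forall>e\<in>Hom N N \<beta> \<beta>. projection e \<and> e \<noteq> 0 \<longrightarrow>
      (\<exists>\<alpha>\<in>C. \<exists>s\<in>Hom N N \<alpha> \<beta>. s\<^sup>\<dagger> * s = 1 \<and> s * s\<^sup>\<dagger> = e)) \<and>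
    (\<forall>\<alpha>\<in>C. \<exists>\<alpha>'\<in>C. conjugate N N \<alpha> \<alpha>')"


section \<open>Q-systems and their extensions\<close>

definition Q_system :: "'h::chilbert_space bop set \<Rightarrow> ('h bop \<Rightarrow> 'h bop) set \<Rightarrow>
    ('h bop \<Rightarrow> 'h bop) \<Rightarrow> 'h bop \<Rightarrow> 'h bop \<Rightarrow> bool" where
  "Q_system N C \<theta> w x \<longleftrightarrow> (let d = sqrt (hom_dim N N \<theta>); \<theta>2 = compose N \<theta> \<theta> in
    \<theta> \<in> C \<and> w \<in> Hom N N (id_hom N) \<theta> \<and> x \<in> Hom N N \<theta> \<theta>2 \<and>
    (w\<^sup>\<dagger> \<otimes>\<^bsub>\<theta>\<^esub> 1) * x = 1 \<and> (1 \<otimes>\<^bsub>\<theta>\<^esub> w\<^sup>\<dagger>) * x = 1 \<and>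
    (x \<otimes>\<^bsub>\<theta>\<^esub> 1) * x = (1 \<otimes>\<^bsub>\<theta>\<^esub> x) * x \<and>
    (1 \<otimes>\<^bsub>\<theta>\<^esub> x\<^sup>\<dagger>) * (x \<otimes>\<^bsub>\<theta>\<^esub> 1) = x * x\<^sup>\<dagger> \<and>
    x * x\<^sup>\<dagger> = (x\<^sup>\<dagger> \<otimes>\<^bsub>\<theta>2\<^esub> 1) * (1 \<otimes>\<^bsub>\<theta>\<^esub> x) \<and>
    w\<^sup>\<dagger> * w = of_real d *\<^sub>C 1 \<and> x\<^sup>\<dagger> * x = of_real d *\<^sub>C 1)"

text \<open>
  The extension is determined up to isomorphism by these relations. The Hilbert space on
  which \<open>M\<close> acts may differ from that of \<open>N\<close>.
\<close>

definition Q_extension :: "'h::chilbert_space bop set \<Rightarrow> ('h bop \<Rightarrow> 'h bop) \<Rightarrow> 'h bop \<Rightarrow>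
    'h bop \<Rightarrow> 'k::chilbert_space bop set \<Rightarrow> ('h bop \<Rightarrow> 'k bop) \<Rightarrow> 'k bop \<Rightarrow> bool" where
  "Q_extension N \<theta> w x M \<iota> v \<longleftrightarrow> von_neumann_algebra M \<and> \<iota> \<in> homs N M \<and> v \<in> M \<and>
    bij_betw (\<lambda>n. \<iota> n * v) N M \<and>
    (\<forall>n\<in>N. v * \<iota> n = \<iota> (\<theta> n) * v) \<and>
    v * v = \<iota> x * v \<and> v\<^sup>\<dagger> = \<iota> (w\<^sup>\<dagger> * x\<^sup>\<dagger>) * v \<and> 1 = \<iota> (w\<^sup>\<dagger>) * v"

definition simple_Q_system :: "'h::chilbert_space bop set \<Rightarrow> ('h bop \<Rightarrow> 'h bop) set \<Rightarrow>
    ('h bop \<Rightarrow> 'h bop) \<Rightarrow> 'h bop \<Rightarrow> 'h bop \<Rightarrow>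
    'k::chilbert_space bop set \<Rightarrow> ('h bop \<Rightarrow> 'k bop) \<Rightarrow> 'k bop \<Rightarrow> bool" where
  "simple_Q_system N C \<theta> w x M \<iota> v \<longleftrightarrow>
    Q_system N C \<theta> w x \<and> Q_extension N \<theta> w x M \<iota> v \<and> factor M"

definition assoc_proj :: "('h::chilbert_space bop \<Rightarrow> 'h bop) \<Rightarrow> 'h bop \<Rightarrow> 'h bop \<Rightarrow> 'h bop \<Rightarrow>
    'h bop" where
  "assoc_proj \<theta> w x p = ((w\<^sup>\<dagger> * p) \<otimes>\<^bsub>\<theta>\<^esub> 1) * x"

end

theory Submission
  imports Defs
begin

text \<open>
  For \<open>f\<close> in \<open>Hom(\<theta>, id)\<close> the two partial evaluations \<open>p = (1 \<times> f) x\<close> and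
  \<open>p' = (f \<times> 1) x\<close> of the comultiplication commute, and \<open>(f \<times> 1 \<times> f) x2 = p' p\<close>. If \<open>p\<close> is a
  comodule projection, then \<open>f = w\<^sup>\<dagger> p = w\<^sup>\<dagger> P\<close>, which gives one direction.

  Conversely take \<open>f = w\<^sup>\<dagger> P\<close>, so that \<open>P = p' p\<close>; that \<open>p\<close> is idempotent is formal, and the point
  is self-adjointness. The operator \<open>x\<^sup>\<dagger> p x\<close> is central in \<open>\<theta>(N) x\<close>, an isomorphic copy of \<open>M\<close>,
  hence equals a scalar \<open>c\<close>. Averaging \<open>P\<close> in two ways gives \<open>x\<^sup>\<dagger> \<theta>(P) x = c p\<close> and
  \<open>x\<^sup>\<dagger> P x = c p'\<close>. The left-hand sides are self-adjoint, and \<open>c = 0\<close> would force \<open>P = 0\<close>; so \<open>p\<close>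
  is an idempotent proportional to its adjoint, hence self-adjoint, then \<open>c\<close> is real and \<open>p'\<close> is
  self-adjoint too. Taking adjoints in \<open>w\<^sup>\<dagger> p = f = w\<^sup>\<dagger> p'\<close> yields \<open>p w = p' w\<close>.
\<close>

section \<open>Adjoints of bounded operators\<close>

text \<open>The real form suffices: \<open>cinner\<close> is recovered from \<open>inner\<close> by
  \<open>cinner_eq_inner\<close>.\<close>

lemma riesz_representation:
  fixes f :: "'a::{real_inner,complete_space} \<Rightarrow> real"
  assumes "bounded_linear f"
  obtains u where "\<And>y. f y = inner u y"
proof -
  interpret f: bounded_linear f by fact
  obtain K where K: "\<And>y. \<bar>f y\<bar> \<le> norm y * K"
    using f.bounded by auto
  \<comment> \<open>The representing vector is the minimiser of \<open>J\<close>.\<close>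
  define J where "J y = inner y y - 2 * f y" for y
  have J_ge: "J y \<ge> - K\<^sup>2" for y
  proof -
    have "J y \<ge> (norm y)\<^sup>2 - 2 * (norm y * K)"
      using K[of y] by (simp add: J_def power2_norm_eq_inner)
    moreover have "(norm y - K)\<^sup>2 \<ge> 0" by simp
    ultimately show ?thesis by (simp add: power2_diff)
  qed
  define m where "m = Inf (range J)"
  have bdd: "bdd_below (range J)"
    using J_ge by (auto intro!: bdd_belowI)
  have m_le: "m \<le> J y" for y
    unfolding m_def using bdd by (intro cInf_lower) auto
  have near: "\<exists>y. J y < m + e" if "e > 0" for e
    using that cInf_less_iff[OF _ bdd, of "m + e"] unfolding m_def by auto
  \<comment> \<open>The parallelogram identity in terms of \<open>J\<close>. As \<open>J\<close> is
    at least \<open>m\<close> at the midpoint, it makes every minimising sequence Cauchy.\<close>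
  have par: "inner (y - z) (y - z) = 2 * J y + 2 * J z - 4 * J ((1/2) *\<^sub>R (y + z))" for y z
    by (simp add: J_def f.add f.scale inner_simps inner_commute algebra_simps)
  obtain s where s: "\<And>n. J (s n) < m + 1 / real (Suc n)"
  proof -
    have "\<exists>s. \<forall>n. J (s n) < m + 1 / real (Suc n)"
      by (intro choice allI near) simp
    then show ?thesis using that by blast
  qed
  have "Cauchy s"
  proof (rule CauchyI)
    fix e :: real assume "e > 0"
    then obtain n0 where n0: "1 / real (Suc n0) < e\<^sup>2 / 4"
      using nat_approx_posE[of "e\<^sup>2 / 4"] by (auto simp: inverse_eq_divide)
    have "norm (s i - s j) < e" if "n0 \<le> i" "n0 \<le> j" for i j
    proof -
      have "1 / real (Suc i) \<le> 1 / real (Suc n0)" "1 / real (Suc j) \<le> 1 / real (Suc n0)"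
        using that by (auto simp: field_simps)
      then have "(norm (s i - s j))\<^sup>2 < e\<^sup>2"
        using par[of "s i" "s j"] s[of i] s[of j] n0 m_le[of "(1/2) *\<^sub>R (s i + s j)"]
        by (simp add: power2_norm_eq_inner)
      then show ?thesis
        using \<open>e > 0\<close> by (simp add: power_less_imp_less_base)
    qed
    then show "\<exists>M. \<forall>i\<ge>M. \<forall>j\<ge>M. norm (s i - s j) < e" by blast
  qed
  then obtain u where u: "s \<longlonglongrightarrow> u"
    using convergent_eq_Cauchy by blast
  have "(\<lambda>n. J (s n)) \<longlonglongrightarrow> J u"
    unfolding J_def by (intro tendsto_intros u f.tendsto)
  moreover have "(\<lambda>n. m + 1 / real (Suc n)) \<longlonglongrightarrow> m + 0"
    by (intro tendsto_intros LIMSEQ_Suc[OF lim_1_over_n])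
  ultimately have "J u \<le> m + 0"
    by (rule LIMSEQ_le) (use s less_imp_le in blast)
  then have J_min: "J u \<le> J z" for z
    using m_le[of z] by simp
  have "f y = inner u y" for y
  proof (rule ccontr)
    define g where "g = f y - inner u y"
    assume "f y \<noteq> inner u y"
    then have g: "g \<noteq> 0" by (simp add: g_def)
    have expand: "J (u + t *\<^sub>R y) = J u + t\<^sup>2 * inner y y - 2 * t * g" for t
      by (simp add: J_def g_def f.add f.scale inner_simps inner_commute algebra_simps
          power2_eq_square)
    have "g \<noteq> 0 \<Longrightarrow> inner y y > 0"
      using f.zero by (auto simp: g_def)
    then have y: "inner y y > 0" using g by simp
    \<comment> \<open>The value \<open>g / inner y y\<close> is the vertex of the parabola in
      \<open>expand\<close>.\<close>
    have "(g / inner y y)\<^sup>2 * inner y y - 2 * (g / inner y y) * g = - g\<^sup>2 / inner y y"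
      using y by (simp add: field_simps power2_eq_square)
    moreover have "- g\<^sup>2 / inner y y < 0"
      using y g by (simp add: divide_neg_pos)
    ultimately show False
      using J_min[of "u + (g / inner y y) *\<^sub>R y"] expand[of "g / inner y y"] by linarith
  qed
  then show ?thesis using that by blast
qed

lemma cinner_eq_inner:
  "cinner x (y :: 'a::chilbert_space) = Complex (inner x y) (- inner x (\<i> *\<^sub>C y))"
proof -
  have "inner x (\<i> *\<^sub>C y) = Re (\<i> * cinner x y)"
    by (simp flip: Re_cinner add: cinner_scaleC_right)
  then show ?thesis
    by (simp add: complex_eq_iff Re_cinner)
qed

lemma cinner_ext:
  assumes "\<And>y. cinner u y = cinner v (y :: 'a::chilbert_space)"
  shows "u = v"
proof -
  have "inner u y = inner v y" for y
    by (simp add: assms flip: Re_cinner)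
  then show ?thesis using vector_eq_rdot[of u v] by blast
qed

section \<open>Existence and calculus of adjoints\<close>

lemma bop_eqI: "(\<And>x. app a x = app b x) \<Longrightarrow> a = b"
  by transfer auto

lemma app_scaleC: "app a (c *\<^sub>C x) = c *\<^sub>C app a x"
  by transfer auto

lemma bounded_linear_app: "bounded_linear (app a)"
  by transfer auto

lemma cinner_scaleC_left: "cinner (c *\<^sub>C x) y = cnj c * cinner x (y :: 'a::chilbert_space)"
  by (subst (1 2) cinner_commute) (simp add: cinner_scaleC_right)

text \<open>Riesz gives \<open>g\<close> for the real inner product only; since \<open>app a\<close>
  commutes with multiplication by i, the same \<open>g\<close> works for \<open>cinner\<close>.
  Linearity then follows from nondegeneracy, boundedness from Cauchy-Schwarz.\<close>

lemma adjoint_exists: "\<exists>b. \<forall>x y. cinner (app b x) y = cinner x (app a (y::'h::chilbert_space))"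
proof -
  interpret a: bounded_linear "app a" by (rule bounded_linear_app)
  have "\<exists>u. \<forall>y. inner x (app a y) = inner u y" for x
  proof -
    have "bounded_linear (\<lambda>y. inner x (app a y))"
      by (rule bounded_linear_compose[OF bounded_linear_inner_right a.bounded_linear_axioms])
    then obtain u where "\<And>y. inner x (app a y) = inner u y"
      by (rule riesz_representation) blast
    then show ?thesis by blast
  qed
  then have "\<exists>g. \<forall>x y. inner x (app a y) = inner (g x) y"
    by (intro choice) blast
  then obtain g where g: "\<And>x y. inner x (app a y) = inner (g x) y"
    by blast
  have cg: "cinner (g x) y = cinner x (app a y)" for x y
    by (simp add: cinner_eq_inner g flip: app_scaleC)
  have add: "g (x + y) = g x + g y" for x y
    by (rule vector_eq_rdot[THEN iffD1], rule allI) (simp add: inner_add_left flip: g)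
  have scale: "g (c *\<^sub>C x) = c *\<^sub>C g x" for c x
    by (rule cinner_ext) (simp add: cinner_scaleC_left cg)
  obtain K where K: "\<And>y. norm (app a y) \<le> norm y * K" using a.bounded by auto
  have "bounded_linear g"
  proof (rule bounded_linear_intro)
    show "g (x + y) = g x + g y" for x y by (rule add)
    show "g (r *\<^sub>R x) = r *\<^sub>R g x" for r x
      using scale[of "of_real r" x] by (simp add: scaleC_of_real)
    show "norm (g x) \<le> norm x * K" for x
    proof (cases "g x = 0")
      \<comment> \<open>The sign of \<open>K\<close> is unknown, so nonnegativity of
        \<open>norm x * K\<close> is read off from the bound at \<open>x\<close>.\<close>
      case True
      have "0 \<le> norm (app a x)" by simp
      also have "\<dots> \<le> norm x * K" by (rule K)
      finally show ?thesis using True by simp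
    next
      case False
      have "norm (g x) * norm (g x) = inner x (app a (g x))"
        by (simp add: g power2_norm_eq_inner flip: power2_eq_square)
      also have "\<dots> \<le> norm x * norm (app a (g x))" by (rule norm_cauchy_schwarz)
      also have "\<dots> \<le> norm x * (norm (g x) * K)" by (rule mult_left_mono[OF K]) simp
      finally show ?thesis using False by (simp add: field_simps)
    qed
  qed
  then have "app (Bop g) = g" by (intro Bop_inverse) (simp add: scale)
  then show ?thesis using cg by (intro exI[of _ "Bop g"]) simp
qed

text \<open>The adjoint is a definite description, so its defining property needs existence and
  uniqueness.\<close>

lemma cinner_adj_left: "cinner (app (a\<^sup>\<dagger>) x) y = cinner x (app a y)"
proof -
  obtain b where b: "\<forall>x y. cinner (app b x) y = cinner x (app a y)"
    using adjoint_exists[of a] by blast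
  have "\<exists>!b. \<forall>x y. cinner (app b x) y = cinner x (app a y)"
  proof (rule ex1I)
    fix b' assume "\<forall>x y. cinner (app b' x) y = cinner x (app a y)"
    then show "b' = b"
      by (intro bop_eqI cinner_ext) (simp add: b)
  qed (rule b)
  then have "\<forall>x y. cinner (app (a\<^sup>\<dagger>) x) y = cinner x (app a y)"
    unfolding adj_def by (rule theI')
  then show ?thesis by blast
qed

lemma adj_unique: "(\<And>x y. cinner (app b x) y = cinner x (app a y)) \<Longrightarrow> a\<^sup>\<dagger> = b"
  by (rule bop_eqI, rule cinner_ext) (simp add: cinner_adj_left)

lemma adj_adj [simp]: "(a\<^sup>\<dagger>)\<^sup>\<dagger> = a"
proof (rule adj_unique)
  fix x y
  have "cinner (app a x) y = cnj (cinner y (app a x))" by (rule cinner_commute)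
  also have "\<dots> = cnj (cinner (app (a\<^sup>\<dagger>) y) x)" by (simp only: cinner_adj_left)
  also have "\<dots> = cinner x (app (a\<^sup>\<dagger>) y)" by (rule cinner_commute[symmetric])
  finally show "cinner (app a x) y = cinner x (app (a\<^sup>\<dagger>) y)" .
qed

lemma adj_mult: "(a * b)\<^sup>\<dagger> = b\<^sup>\<dagger> * a\<^sup>\<dagger>"
  by (rule adj_unique) (simp add: times_bop.rep_eq cinner_adj_left)

lemma adj_one [simp]: "1\<^sup>\<dagger> = 1"
  by (rule adj_unique) (simp add: one_bop.rep_eq)

lemma adj_scaleC: "(c *\<^sub>C a)\<^sup>\<dagger> = cnj c *\<^sub>C a\<^sup>\<dagger>"
  by (rule adj_unique)
    (simp add: scaleC_bop.rep_eq cinner_adj_left cinner_scaleC_left cinner_scaleC_right)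

lemma adj_mult_self_eq_0: "a\<^sup>\<dagger> * a = 0 \<Longrightarrow> a = 0"
proof (rule bop_eqI)
  fix x assume "a\<^sup>\<dagger> * a = 0"
  then have "app (a\<^sup>\<dagger> * a) x = 0"
    by (simp add: zero_bop.rep_eq)
  then have "inner (app (a\<^sup>\<dagger>) (app a x)) x = 0"
    by (simp add: times_bop.rep_eq)
  then have "inner (app a x) (app a x) = 0"
    by (simp add: cinner_adj_left flip: Re_cinner)
  then show "app a x = app 0 x" by (simp add: zero_bop.rep_eq)
qed

section \<open>Complex scalars, and idempotents proportional to their adjoints\<close>

lemma scaleC_mult_left [simp]: "(c *\<^sub>C a) * b = c *\<^sub>C (a * (b :: 'h::chilbert_space bop))"
  by transfer auto

lemma scaleC_mult_right [simp]: "a * (c *\<^sub>C b) = c *\<^sub>C (a * (b :: 'h::chilbert_space bop))"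
  by transfer auto

lemma scaleC_scaleC_bop [simp]: "c *\<^sub>C d *\<^sub>C a = (c * d) *\<^sub>C (a :: 'h::chilbert_space bop)"
  by transfer (simp add: scaleC_scaleC)

lemma scaleC_one_bop [simp]: "1 *\<^sub>C a = (a :: 'h::chilbert_space bop)"
  using scaleC_of_real[of 1, where ?'a = 'h] by transfer simp

lemma scaleC_zero_bop [simp]: "0 *\<^sub>C a = (0 :: 'h::chilbert_space bop)"
  using scaleC_of_real[of 0, where ?'a = 'h] by transfer simp

lemma scaleC_cancel_bop:
  assumes "c \<noteq> 0" and "c *\<^sub>C a = c *\<^sub>C (b :: 'h::chilbert_space bop)"
  shows "a = b"
proof -
  have "inverse c *\<^sub>C c *\<^sub>C a = inverse c *\<^sub>C c *\<^sub>C b" by (simp only: assms(2))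
  then show ?thesis using assms(1) by simp
qed

lemma adj_zero [simp]: "(0 :: 'h::chilbert_space bop)\<^sup>\<dagger> = 0"
  using adj_scaleC[of 0 "1 :: 'h bop"] by simp

text \<open>Proportionality alone would leave a phase \<open>c\<close>. The adjoint is idempotent
  too, which gives \<open>c * c\<close> and \<open>c\<close> the same effect on
  \<open>p\<close>.\<close>

lemma idempotent_adj_multiple:
  fixes p :: "'h::chilbert_space bop"
  assumes "p * p = p" and "p\<^sup>\<dagger> = c *\<^sub>C p"
  shows "p\<^sup>\<dagger> = p"
proof (cases "c = 0")
  case True
  then have 0: "p\<^sup>\<dagger> = 0" using assms(2) by simp
  have "p = (p\<^sup>\<dagger>)\<^sup>\<dagger>" by simp
  also have "\<dots> = 0" by (simp only: 0 adj_zero)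
  finally show ?thesis using 0 by simp
next
  case False
  have "p\<^sup>\<dagger> * p\<^sup>\<dagger> = p\<^sup>\<dagger>" by (simp flip: adj_mult add: assms(1))
  then have "c *\<^sub>C (c *\<^sub>C p) = c *\<^sub>C p"
    by (simp add: assms)
  then have "c *\<^sub>C p = p" by (rule scaleC_cancel_bop[OF False])
  then show ?thesis by (simp add: assms(2))
qed

text \<open>Lets an identity between two-fold products rewrite the inside of a right-nested
  product.\<close>

lemma mult_assoc_cong: "a * b = c * d \<Longrightarrow> a * (b * e) = c * (d * (e :: 'h::chilbert_space bop))"
  by (simp flip: mult.assoc)

section \<open>The Frobenius algebra of a simple Q-system\<close>

text \<open>
  The assumption \<open>simple\<close> says that the centre of the algebra \<open>\<theta>(N) x\<close> is trivial: its elements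
  are the \<open>q\<close> with \<open>\<theta> q * x = x * q\<close>, and \<open>q\<close> commutes with \<open>\<theta>(N)\<close> and with \<open>x\<close>.
\<close>

locale simple_frobenius =
  fixes N :: "'h::chilbert_space bop set" and \<theta> :: "'h bop \<Rightarrow> 'h bop" and w x :: "'h bop"
  assumes mult_closed: "a \<in> N \<Longrightarrow> b \<in> N \<Longrightarrow> a * b \<in> N"
    and adj_closed: "a \<in> N \<Longrightarrow> a\<^sup>\<dagger> \<in> N"
    and \<theta>_closed: "a \<in> N \<Longrightarrow> \<theta> a \<in> N"
    and \<theta>_mult: "a \<in> N \<Longrightarrow> b \<in> N \<Longrightarrow> \<theta> (a * b) = \<theta> a * \<theta> b"
    and \<theta>_adj: "a \<in> N \<Longrightarrow> \<theta> (a\<^sup>\<dagger>) = (\<theta> a)\<^sup>\<dagger>"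
    and w_closed: "w \<in> N" and x_closed: "x \<in> N"
    and w_intertwines: "a \<in> N \<Longrightarrow> w * a = \<theta> a * w"
    and x_intertwines: "a \<in> N \<Longrightarrow> x * \<theta> a = \<theta> (\<theta> a) * x"
    and counit_left: "w\<^sup>\<dagger> * x = 1" and counit_right: "\<theta> (w\<^sup>\<dagger>) * x = 1"
    and coassoc: "x * x = \<theta> x * x"
    and frob_left: "\<theta> (x\<^sup>\<dagger>) * x = x * x\<^sup>\<dagger>" and frob_right: "x\<^sup>\<dagger> * \<theta> x = x * x\<^sup>\<dagger>"
    and simple: "\<lbrakk>q \<in> Hom N N \<theta> \<theta>; \<theta> q * x = x * q; q * x = x * q\<rbrakk> \<Longrightarrow> \<exists>c. q = c *\<^sub>C 1"
begin

lemma Hom_closed: "t \<in> Hom N N \<theta> \<theta> \<Longrightarrow> t \<in> N"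
  by (simp add: Hom_def)

lemma Hom_commutes: "t \<in> Hom N N \<theta> \<theta> \<Longrightarrow> a \<in> N \<Longrightarrow> t * \<theta> a = \<theta> a * t"
  by (simp add: Hom_def)

lemma adj_w_x_closed: "w\<^sup>\<dagger> \<in> N" "x\<^sup>\<dagger> \<in> N"
  by (simp_all add: adj_closed w_closed x_closed)

lemma counit_intertwines:
  assumes "a \<in> N" shows "w\<^sup>\<dagger> * \<theta> a = a * w\<^sup>\<dagger>"
proof -
  have "(w * a\<^sup>\<dagger>)\<^sup>\<dagger> = (\<theta> (a\<^sup>\<dagger>) * w)\<^sup>\<dagger>"
    using w_intertwines[of "a\<^sup>\<dagger>"] assms by (simp add: adj_closed)
  then show ?thesis using assms by (simp add: adj_mult \<theta>_adj)
qed

lemma adj_x_intertwines: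
  assumes "a \<in> N" shows "x\<^sup>\<dagger> * \<theta> (\<theta> a) = \<theta> a * x\<^sup>\<dagger>"
proof -
  have "(x * \<theta> (a\<^sup>\<dagger>))\<^sup>\<dagger> = (\<theta> (\<theta> (a\<^sup>\<dagger>)) * x)\<^sup>\<dagger>"
    using x_intertwines[of "a\<^sup>\<dagger>"] assms by (simp add: adj_closed)
  then show ?thesis using assms by (simp add: adj_mult \<theta>_adj \<theta>_closed)
qed

text \<open>This is Hom(\<theta>, id), with the extensional \<open>id_hom\<close> unfolded.\<close>

definition functional :: "'h bop \<Rightarrow> bool" where
  "functional f \<longleftrightarrow> f \<in> N \<and> (\<forall>a\<in>N. f * \<theta> a = a * f)"

lemma functional_closed: "functional f \<Longrightarrow> f \<in> N"
  by (simp add: functional_def)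

lemma functional_intertwines: "functional f \<Longrightarrow> a \<in> N \<Longrightarrow> f * \<theta> a = a * f"
  by (simp add: functional_def)

lemma functional_counit:
  assumes t: "t \<in> Hom N N \<theta> \<theta>"
  shows "functional (w\<^sup>\<dagger> * t)"
  unfolding functional_def
  by (simp add: mult_closed adj_w_x_closed Hom_closed t mult.assoc Hom_commutes[OF t]
      mult_assoc_cong[OF counit_intertwines])

section \<open>Slices of the comultiplication\<close>

lemma right_slice_Hom:
  assumes f: "functional f"
  shows "\<theta> f * x \<in> Hom N N \<theta> \<theta>"
proof -
  have comm: "\<theta> f * \<theta> (\<theta> a) = \<theta> a * \<theta> f" if "a \<in> N" for a
    using f that by (simp add: functional_closed functional_intertwines \<theta>_closed flip: \<theta>_mult)
  then show ?thesis
    using f unfolding Hom_def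
    by (simp add: functional_closed mult_closed \<theta>_closed x_closed mult.assoc x_intertwines
        mult_assoc_cong[OF comm])
qed

lemma left_slice_Hom:
  assumes f: "functional f"
  shows "f * x \<in> Hom N N \<theta> \<theta>"
  using f unfolding Hom_def
  by (simp add: functional_closed mult_closed x_closed mult.assoc x_intertwines \<theta>_closed
      mult_assoc_cong[OF functional_intertwines])

text \<open>Here \<open>f\<close> acts on the last leg, so coassociativity lets \<open>x\<close> act
  on the other one undisturbed.\<close>

lemma right_slice_comodule:
  assumes f: "functional f"
  shows "\<theta> (\<theta> f * x) * x = x * (\<theta> f * x)"
  using functional_closed[OF f]
  by (simp add: \<theta>_mult \<theta>_closed x_closed mult.assoc mult_assoc_cong[OF x_intertwines]
      flip: coassoc)

lemma left_slice_comodule: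
  assumes f: "functional f"
  shows "(f * x) * x = x * (f * x)"
  by (simp add: mult.assoc coassoc mult_assoc_cong[OF functional_intertwines[OF f x_closed]])

text \<open>Both sides apply \<open>f\<close> to the middle leg of the iterated
  comultiplication.\<close>

lemma slices_exchange:
  assumes f: "functional f"
  shows "(\<theta> f * x) * x = \<theta> (f * x) * x"
  using functional_closed[OF f] by (simp add: \<theta>_mult x_closed mult.assoc coassoc)

text \<open>As an endomorphism of \<theta> the left slice passes \<open>\<theta> f\<close>, and as a
  comodule map it passes \<open>x\<close>.\<close>

lemma slices_commute:
  assumes f: "functional f"
  shows "(f * x) * (\<theta> f * x) = (\<theta> f * x) * (f * x)"
proof -
  have comm: "(f * x) * \<theta> f = \<theta> f * (f * x)"
    by (rule Hom_commutes[OF left_slice_Hom[OF f] functional_closed[OF f]])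
  have "(f * x) * (\<theta> f * x) = ((f * x) * \<theta> f) * x" by (simp only: mult.assoc)
  also have "\<dots> = \<theta> f * (f * x) * x" by (simp only: comm)
  also have "\<dots> = \<theta> f * ((f * x) * x)" by (simp only: mult.assoc)
  also have "\<dots> = \<theta> f * (x * (f * x))" by (simp only: left_slice_comodule[OF f])
  finally show ?thesis by (simp only: mult.assoc)
qed

text \<open>The left side is (f \<times> 1 \<times> f) x2, with \<open>f\<close> on both outer
  legs.\<close>

lemma double_slice:
  assumes f: "functional f"
  shows "f * \<theta> (\<theta> f) * (x * x) = (f * x) * (\<theta> f * x)"
  using functional_closed[OF f] by (simp add: mult.assoc mult_assoc_cong[OF x_intertwines])

lemma counit_right_slice:
  assumes f: "functional f" shows "w\<^sup>\<dagger> * (\<theta> f * x) = f"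
  using functional_closed[OF f]
  by (simp add: mult_assoc_cong[OF counit_intertwines] counit_left)

lemma counit_left_slice:
  assumes f: "functional f" shows "w\<^sup>\<dagger> * (f * x) = f"
proof -
  have "w\<^sup>\<dagger> * (f * x) = f * (\<theta> (w\<^sup>\<dagger>) * x)"
    by (simp add: functional_intertwines[OF f adj_w_x_closed(1)] flip: mult.assoc)
  then show ?thesis by (simp add: counit_right)
qed

text \<open>Converse of \<open>right_slice_comodule\<close>: the counit on the second leg of
  \<open>x * p\<close> returns \<open>p\<close>.\<close>

lemma comodule_map_eq_right_slice:
  assumes "p \<in> N" and "\<theta> p * x = x * p"
  shows "p = \<theta> (w\<^sup>\<dagger> * p) * x"
proof -
  have "\<theta> (w\<^sup>\<dagger> * p) * x = (\<theta> (w\<^sup>\<dagger>) * x) * p"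
    by (simp add: \<theta>_mult adj_w_x_closed assms mult.assoc)
  then show ?thesis by (simp add: counit_right)
qed

text \<open>Each centrality condition in \<open>simple\<close> uses coassociativity, one half of the
  Frobenius relation and one property of \<open>p\<close>: the comodule relation for the first,
  commutation with \<open>\<theta> x\<close> for the second.\<close>

lemma average_scalar:
  assumes "p \<in> Hom N N \<theta> \<theta>" and "\<theta> p * x = x * p"
  shows "\<exists>c. x\<^sup>\<dagger> * p * x = c *\<^sub>C 1"
proof (rule simple)
  have pN: "p \<in> N" using assms by (simp add: Hom_closed)
  show "x\<^sup>\<dagger> * p * x \<in> Hom N N \<theta> \<theta>"
    using pN unfolding Hom_def
    by (simp add: mult_closed adj_w_x_closed x_closed mult.assoc x_intertwines \<theta>_closed
        mult_assoc_cong[OF Hom_commutes[OF assms(1)]] mult_assoc_cong[OF adj_x_intertwines])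
  have "\<theta> (x\<^sup>\<dagger> * p * x) * x = \<theta> (x\<^sup>\<dagger>) * \<theta> p * (\<theta> x * x)"
    by (simp add: \<theta>_mult adj_w_x_closed mult_closed pN x_closed mult.assoc)
  also have "\<dots> = \<theta> (x\<^sup>\<dagger>) * (\<theta> p * x) * x"
    by (simp add: mult.assoc flip: coassoc)
  also have "\<dots> = (\<theta> (x\<^sup>\<dagger>) * x) * p * x"
    by (simp add: assms(2) mult.assoc)
  also have "\<dots> = x * (x\<^sup>\<dagger> * p * x)"
    by (simp add: frob_left mult.assoc)
  finally show "\<theta> (x\<^sup>\<dagger> * p * x) * x = x * (x\<^sup>\<dagger> * p * x)" .
  have "(x\<^sup>\<dagger> * p * x) * x = x\<^sup>\<dagger> * (p * \<theta> x) * x"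
    by (simp add: mult.assoc coassoc)
  also have "\<dots> = (x\<^sup>\<dagger> * \<theta> x) * p * x"
    by (simp add: Hom_commutes[OF assms(1) x_closed] mult.assoc)
  also have "\<dots> = x * (x\<^sup>\<dagger> * p * x)"
    by (simp add: frob_right mult.assoc)
  finally show "(x\<^sup>\<dagger> * p * x) * x = x * (x\<^sup>\<dagger> * p * x)" .
qed

lemma selfadjoint_slices:
  assumes f: "functional f"
    and P: "P = (f * x) * (\<theta> f * x)" "P\<^sup>\<dagger> = P" "P * P = P" and fP: "w\<^sup>\<dagger> * P = f"
    and idem: "(\<theta> f * x) * (\<theta> f * x) = \<theta> f * x"
  shows "(\<theta> f * x)\<^sup>\<dagger> = \<theta> f * x" and "(f * x)\<^sup>\<dagger> = f * x"
proof -
  define p where "p = \<theta> f * x"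
  define p' where "p' = f * x"
  have pH: "p \<in> Hom N N \<theta> \<theta>" and p'H: "p' \<in> Hom N N \<theta> \<theta>"
    using f by (simp_all add: p_def p'_def left_slice_Hom right_slice_Hom)
  have mem: "p \<in> N" "p' \<in> N" using pH p'H by (simp_all add: Hom_closed)
  have px: "\<theta> p * x = x * p" and p'x: "p' * x = x * p'" and ex: "p * x = \<theta> p' * x"
    using f by (simp_all add: p_def p'_def right_slice_comodule left_slice_comodule
        slices_exchange)
  have P': "P = p' * p" "P = p * p'"
    using P(1) slices_commute[OF f] by (simp_all add: p_def p'_def)
  have PN: "P \<in> N" by (simp add: P' mult_closed mem)
  obtain c where c: "x\<^sup>\<dagger> * p * x = c *\<^sub>C 1"
    using average_scalar[OF pH px] by blast
  \<comment> \<open>The comodule relation moves \<open>p\<close> out to the right, and the exchange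
    relation turns the remaining average of \<open>\<theta> p'\<close> into that of
    \<open>p\<close>.\<close>
  have "x\<^sup>\<dagger> * \<theta> P * x = (x\<^sup>\<dagger> * (\<theta> p' * x)) * p"
    by (simp add: P'(1) \<theta>_mult mem mult.assoc px)
  also have "\<dots> = c *\<^sub>C p"
    using c by (simp flip: ex add: mult.assoc[symmetric])
  finally have 1: "x\<^sup>\<dagger> * \<theta> P * x = c *\<^sub>C p" .
  \<comment> \<open>With the factors of \<open>P\<close> in the other order it is \<open>p'\<close>
    that moves out, and the same scalar \<open>c\<close> remains.\<close>
  have "x\<^sup>\<dagger> * P * x = (x\<^sup>\<dagger> * p * x) * p'"
    by (simp add: P'(2) mult.assoc p'x)
  then have 2: "x\<^sup>\<dagger> * P * x = c *\<^sub>C p'"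
    by (simp add: c)
  have "(x\<^sup>\<dagger> * \<theta> P * x)\<^sup>\<dagger> = x\<^sup>\<dagger> * \<theta> P * x"
    by (simp add: adj_mult mult.assoc P(2) PN flip: \<theta>_adj)
  then have 3: "cnj c *\<^sub>C p\<^sup>\<dagger> = c *\<^sub>C p"
    by (simp add: 1 adj_scaleC)
  have "(x\<^sup>\<dagger> * P * x)\<^sup>\<dagger> = x\<^sup>\<dagger> * P * x"
    by (simp add: adj_mult mult.assoc P(2))
  then have 4: "cnj c *\<^sub>C p'\<^sup>\<dagger> = c *\<^sub>C p'"
    by (simp add: 2 adj_scaleC)
  have "p\<^sup>\<dagger> = p \<and> p'\<^sup>\<dagger> = p'"
  proof (cases "c = 0")
    case True
    \<comment> \<open>As \<open>P\<close> is a projection, its vanishing average is the square of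
      \<open>\<theta> P * x\<close>, from which the counit recovers \<open>p\<close>.\<close>
    have "(\<theta> P * x)\<^sup>\<dagger> * (\<theta> P * x) = x\<^sup>\<dagger> * (\<theta> P * \<theta> P) * x"
      using \<theta>_adj[OF PN] by (simp add: adj_mult mult.assoc P(2))
    also have "\<dots> = 0" using 1 True by (simp add: P(3) PN flip: \<theta>_mult)
    finally have "\<theta> P * x = 0" by (rule adj_mult_self_eq_0)
    moreover have "p = \<theta> (w\<^sup>\<dagger>) * (\<theta> P * x)"
      by (simp add: p_def fP[symmetric] \<theta>_mult adj_w_x_closed PN mult.assoc)
    ultimately have "p = 0" by simp
    then have "P = 0" by (simp add: P')
    then have "p' = 0" using fP by (simp add: p'_def)
    then show ?thesis using \<open>p = 0\<close> \<open>p' = 0\<close> by simp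
  next
    case False
    then have c0: "cnj c \<noteq> 0" by simp
    then have "cnj c * (inverse (cnj c) * c) = c" by (simp flip: mult.assoc)
    then have "cnj c *\<^sub>C p\<^sup>\<dagger> = cnj c *\<^sub>C (inverse (cnj c) * c) *\<^sub>C p"
      by (simp only: scaleC_scaleC_bop 3)
    then have "p\<^sup>\<dagger> = (inverse (cnj c) * c) *\<^sub>C p"
      by (rule scaleC_cancel_bop[OF c0])
    then have p: "p\<^sup>\<dagger> = p"
      by (rule idempotent_adj_multiple[OF idem[folded p_def]])
    \<comment> \<open>Only \<open>p\<close> is assumed idempotent, so \<open>p'\<close> needs
      another argument: self-adjointness of \<open>p\<close> makes \<open>c\<close> real, and
      \<open>c\<close> then cancels in fact \<open>4\<close>.\<close>
    have "(x\<^sup>\<dagger> * p * x)\<^sup>\<dagger> = x\<^sup>\<dagger> * p * x" by (simp add: adj_mult mult.assoc p)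
    then have "cnj c *\<^sub>C (1::'h bop) = c *\<^sub>C 1" by (simp add: c adj_scaleC)
    then have "(cnj c *\<^sub>C 1) * p' = (c *\<^sub>C 1) * p'" by (simp only:)
    then have "cnj c *\<^sub>C p'\<^sup>\<dagger> = cnj c *\<^sub>C p'" using 4 by simp
    then have "p'\<^sup>\<dagger> = p'" by (rule scaleC_cancel_bop[OF c0])
    with p show ?thesis by simp
  qed
  then show "(\<theta> f * x)\<^sup>\<dagger> = \<theta> f * x" "(f * x)\<^sup>\<dagger> = f * x"
    by (simp_all add: p_def p'_def)
qed

lemma slices_unit:
  assumes f: "functional f" and "(\<theta> f * x)\<^sup>\<dagger> = \<theta> f * x" and "(f * x)\<^sup>\<dagger> = f * x"
  shows "\<theta> f * x * w = f * x * w"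
proof -
  have "w\<^sup>\<dagger> * (\<theta> f * x) = w\<^sup>\<dagger> * (f * x)"
    using f by (simp add: counit_right_slice counit_left_slice)
  then have "(w\<^sup>\<dagger> * (\<theta> f * x))\<^sup>\<dagger> = (w\<^sup>\<dagger> * (f * x))\<^sup>\<dagger>" by simp
  then show ?thesis by (simp add: adj_mult[of "w\<^sup>\<dagger>"] assms)
qed

text \<open>The theorem with all tensor products of intertwiners written as operator
  products.\<close>

lemma product_of_slices_iff:
  assumes P: "P \<in> Hom N N \<theta> \<theta>" "projection P"
  shows "(\<exists>p \<in> Hom N N \<theta> \<theta>. projection p \<and> \<theta> p * x = x * p \<and>
            p * w = w\<^sup>\<dagger> * p * x * w \<and> P = w\<^sup>\<dagger> * p * x * p)
     \<longleftrightarrow> w\<^sup>\<dagger> * P * \<theta> (\<theta> (w\<^sup>\<dagger> * P)) * (x * x) = P" (is "?L \<longleftrightarrow> ?R")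
proof
  assume ?L
  then obtain p where p: "p \<in> Hom N N \<theta> \<theta>" "p * p = p" "\<theta> p * x = x * p"
    "P = w\<^sup>\<dagger> * p * x * p"
    by (auto simp: projection_def)
  define f where "f = w\<^sup>\<dagger> * p"
  have f: "functional f" using p by (simp add: f_def functional_counit)
  have p_eq: "p = \<theta> f * x"
    unfolding f_def using p by (intro comodule_map_eq_right_slice) (auto simp: Hom_closed)
  have "P = (f * x) * p" unfolding f_def by (rule p(4))
  then have P_eq: "P = (f * x) * (\<theta> f * x)" by (simp only: p_eq[symmetric])
  \<comment> \<open>The right-hand side of the equivalence is stated with
    \<open>w\<^sup>\<dagger> * P\<close>, so this must be identified with \<open>f\<close>.\<close>
  have "w\<^sup>\<dagger> * P = (w\<^sup>\<dagger> * (f * x)) * p"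
    by (simp only: P_eq p_eq[symmetric] mult.assoc)
  also have "\<dots> = f * p" by (simp add: counit_left_slice f)
  also have "\<dots> = f" by (simp add: f_def mult.assoc p(2))
  finally have "w\<^sup>\<dagger> * P = f" .
  then show ?R by (simp only: double_slice[OF f] P_eq[symmetric])
next
  assume R: ?R
  define f where "f = w\<^sup>\<dagger> * P"
  have f: "functional f" using P by (simp add: f_def functional_counit)
  define p where "p = \<theta> f * x"
  have pH: "p \<in> Hom N N \<theta> \<theta>" unfolding p_def using f by (rule right_slice_Hom)
  have px: "\<theta> p * x = x * p" unfolding p_def using f by (rule right_slice_comodule)
  have wp: "w\<^sup>\<dagger> * p = f" unfolding p_def using f by (rule counit_right_slice)
  have P_eq: "P = (f * x) * p"
    using R unfolding f_def[symmetric] double_slice[OF f] p_def[symmetric] by (rule sym)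
  have "f = w\<^sup>\<dagger> * ((f * x) * p)" unfolding P_eq[symmetric] by (rule f_def)
  also have "\<dots> = (w\<^sup>\<dagger> * (f * x)) * p" by (simp only: mult.assoc)
  finally have fp: "f * p = f" by (simp only: counit_left_slice[OF f])
  \<comment> \<open>The comodule relation makes \<open>p * p\<close> the right slice of
    \<open>f * p\<close>, which equals \<open>f\<close>.\<close>
  have "p * p = \<theta> f * (\<theta> p * x)" by (simp add: px) (simp add: p_def mult.assoc)
  also have "\<dots> = \<theta> (f * p) * x"
    using f pH by (simp add: functional_def Hom_closed \<theta>_mult mult.assoc)
  also have "\<dots> = p" unfolding fp by (rule p_def[symmetric])
  finally have idem: "p * p = p" .
  have sa: "p\<^sup>\<dagger> = p" "(f * x)\<^sup>\<dagger> = f * x"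
    using selfadjoint_slices[OF f P_eq[unfolded p_def] _ _ f_def[symmetric] idem[unfolded p_def]]
      P(2) by (simp_all only: projection_def p_def)
  have "p * w = f * x * w"
    using slices_unit[OF f] sa by (simp add: p_def)
  then show ?L
    unfolding projection_def
  proof (intro bexI[of _ p] conjI)
    show "P = w\<^sup>\<dagger> * p * x * p" unfolding wp by (rule P_eq)
  qed (use pH px idem sa(1) in \<open>simp_all add: wp\<close>)
qed

end

section \<open>Q-systems\<close>

text \<open>By hypothesis \<open>N\<close> is itself a commutant, hence a unital algebra.\<close>

lemma commutant_closed:
  assumes "commutant (commutant N) = N"
  shows "1 \<in> N" "a \<in> N \<Longrightarrow> b \<in> N \<Longrightarrow> a * b \<in> N" "a \<in> N \<Longrightarrow> c *\<^sub>C a \<in> N"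
proof -
  have mem: "y \<in> N \<longleftrightarrow> (\<forall>z\<in>commutant N. z * y = y * z)" for y
    using assms unfolding commutant_def by blast
  show "1 \<in> N" by (simp add: mem)
  show "a \<in> N \<Longrightarrow> b \<in> N \<Longrightarrow> a * b \<in> N"
  proof (unfold mem, rule ballI)
    fix z assume *: "\<forall>z\<in>commutant N. z * a = a * z" "\<forall>z\<in>commutant N. z * b = b * z"
      "z \<in> commutant N"
    then have "z * (a * b) = a * (z * b)" by (intro mult_assoc_cong) blast
    then show "z * (a * b) = a * b * z" using * by (simp add: mult.assoc)
  qed
  show "a \<in> N \<Longrightarrow> c *\<^sub>C a \<in> N"
    unfolding mem by simp
qed

text \<open>Transports the product of \<open>M\<close> to \<open>N\<close> along the bijection
  sending \<open>n\<close> to \<open>\<iota> n * v\<close>.\<close>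

lemma Q_extension_mult:
  assumes "Q_extension N \<theta> w x M \<iota> v" "commutant (commutant N) = N"
    and "x \<in> N" "\<theta> b \<in> N" "a \<in> N" "b \<in> N"
  shows "(\<iota> a * v) * (\<iota> b * v) = \<iota> (a * \<theta> b * x) * v"
proof -
  have \<iota>: "\<iota> \<in> homs N M" and v: "v * v = \<iota> x * v" "v * \<iota> b = \<iota> (\<theta> b) * v"
    using assms by (simp_all add: Q_extension_def)
  have mult: "\<iota> (s * t) = \<iota> s * \<iota> t" if "s \<in> N" "t \<in> N" for s t
    using \<iota> that by (simp add: homs_def)
  have "(\<iota> a * v) * (\<iota> b * v) = \<iota> a * (v * \<iota> b) * v" by (simp add: mult.assoc)
  also have "\<dots> = \<iota> a * \<iota> (\<theta> b) * (v * v)" by (simp add: v(2) mult.assoc)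
  also have "\<dots> = \<iota> (a * \<theta> b * x) * v"
    using assms by (simp add: v(1) mult commutant_closed mult.assoc)
  finally show ?thesis .
qed

text \<open>The point is \<open>simple\<close>. A central \<open>q\<close> is the right slice of
  \<open>n = w\<^sup>\<dagger> * q\<close>, and its two relations make \<open>\<iota> n * v\<close>
  central in the factor \<open>M\<close>.\<close>

lemma simple_Q_system_frobenius:
  assumes "von_neumann_algebra N" and sub: "full_tensor_subcategory N C"
    and A: "simple_Q_system N C \<theta> w x M \<iota> v"
  shows "simple_frobenius N \<theta> w x"
proof -
  have N2: "commutant (commutant N) = N" and adj_N: "\<And>a. a \<in> N \<Longrightarrow> a\<^sup>\<dagger> \<in> N"
    using assms(1) by (auto simp: von_neumann_algebra_def)
  note [simp] = commutant_closed[OF N2] adj_N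
  have Q: "Q_system N C \<theta> w x" and E: "Q_extension N \<theta> w x M \<iota> v" and M: "factor M"
    using A by (auto simp: simple_Q_system_def)
  have "\<theta> \<in> homs N N"
    using Q sub by (auto simp: Q_system_def Let_def full_tensor_subcategory_def End0_def)
  then have \<theta>: "\<And>a. a \<in> N \<Longrightarrow> \<theta> a \<in> N" "\<theta> 1 = 1"
    "\<And>a b. a \<in> N \<Longrightarrow> b \<in> N \<Longrightarrow> \<theta> (a * b) = \<theta> a * \<theta> b"
    "\<And>a. a \<in> N \<Longrightarrow> \<theta> (a\<^sup>\<dagger>) = (\<theta> a)\<^sup>\<dagger>"
    "\<And>c a. a \<in> N \<Longrightarrow> \<theta> (c *\<^sub>C a) = c *\<^sub>C \<theta> a"
    by (auto simp: homs_def)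
  have wx: "w \<in> N" "x \<in> N" "\<And>a. a \<in> N \<Longrightarrow> w * a = \<theta> a * w"
    "\<And>a. a \<in> N \<Longrightarrow> x * \<theta> a = \<theta> (\<theta> a) * x"
    "w\<^sup>\<dagger> * x = 1" "\<theta> (w\<^sup>\<dagger>) * x = 1" "x * x = \<theta> x * x"
    "\<theta> (x\<^sup>\<dagger>) * x = x * x\<^sup>\<dagger>" "x * x\<^sup>\<dagger> = x\<^sup>\<dagger> * \<theta> x"
    using Q by (auto simp: Q_system_def Let_def Hom_def hom_times_def id_hom_def compose_def \<theta>)
  have wt: "w\<^sup>\<dagger> * \<theta> a = a * w\<^sup>\<dagger>" if "a \<in> N" for a
  proof -
    have "(w * a\<^sup>\<dagger>)\<^sup>\<dagger> = (\<theta> (a\<^sup>\<dagger>) * w)\<^sup>\<dagger>" using wx(3)[of "a\<^sup>\<dagger>"] that by simp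
    then show ?thesis using that by (simp add: adj_mult \<theta>)
  qed
  have bij: "bij_betw (\<lambda>n. \<iota> n * v) N M" and \<iota>: "\<iota> \<in> homs N M" and one: "1 = \<iota> (w\<^sup>\<dagger>) * v"
    using E by (simp_all add: Q_extension_def)
  show ?thesis
  proof
    fix q assume q: "q \<in> Hom N N \<theta> \<theta>" "\<theta> q * x = x * q" "q * x = x * q"
    then have qN: "q \<in> N" and q_comm: "\<And>a. a \<in> N \<Longrightarrow> q * \<theta> a = \<theta> a * q"
      by (auto simp: Hom_def)
    define n where "n = w\<^sup>\<dagger> * q"
    have nN: "n \<in> N" using wx qN by (simp add: n_def)
    have q_eq: "q = \<theta> n * x"
    proof -
      have "\<theta> n * x = (\<theta> (w\<^sup>\<dagger>) * x) * q"
        by (simp add: n_def \<theta> wx(1) qN q(2) mult.assoc)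
      then show ?thesis by (simp add: wx)
    qed
    \<comment> \<open>Commutation of \<open>n\<close> with \<open>m\<close> in the product
      transported from \<open>M\<close>.\<close>
    have comm: "m * \<theta> n * x = n * \<theta> m * x" if "m \<in> N" for m
    proof -
      have "n * \<theta> m * x = (w\<^sup>\<dagger> * \<theta> m) * (q * x)"
        by (simp add: n_def mult.assoc mult_assoc_cong[OF q_comm[OF that]])
      also have "\<dots> = m * (w\<^sup>\<dagger> * x) * q"
        by (simp add: wt[OF that] q(3)) (simp add: mult.assoc)
      finally show ?thesis by (simp add: wx(5) q_eq mult.assoc)
    qed
    have "\<iota> n * v \<in> M" using bij nN by (auto simp: bij_betw_def)
    moreover have "\<iota> n * v \<in> commutant M"
      unfolding commutant_def
    proof safe
      fix a assume "a \<in> M"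
      then obtain m where m: "m \<in> N" "a = \<iota> m * v" using bij by (auto simp: bij_betw_def)
      then show "a * (\<iota> n * v) = \<iota> n * v * a"
        using nN wx \<theta>(1) by (simp add: Q_extension_mult[OF E N2] comm)
    qed
    ultimately obtain c where "\<iota> n * v = c *\<^sub>C 1"
      using M by (auto simp: factor_def)
    \<comment> \<open>The unit of \<open>M\<close> corresponds to \<open>w\<^sup>\<dagger>\<close>;
      injectivity then determines \<open>n\<close>, and the counit law gives
      \<open>q\<close>.\<close>
    also have "\<dots> = \<iota> (c *\<^sub>C w\<^sup>\<dagger>) * v"
      using \<iota> wx by (simp add: one homs_def)
    finally have "n = c *\<^sub>C w\<^sup>\<dagger>"
      using bij nN wx by (auto simp: bij_betw_def dest: inj_onD)
    then show "\<exists>c. q = c *\<^sub>C 1"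
      using q_eq wx \<theta> by auto
  qed (use \<theta> wx in simp_all)
qed

theorem proposition4p8:
  fixes N :: "'h::{chilbert_space, second_countable_topology} bop set"
    and C :: "('h bop \<Rightarrow> 'h bop) set"
    and \<theta> :: "'h bop \<Rightarrow> 'h bop"
    and w x P :: "'h bop"
    and M :: "'k::chilbert_space bop set"
    and \<iota> :: "'h bop \<Rightarrow> 'k bop"
    and v :: "'k bop"
  assumes "factor N" and "type_III N"
    and "full_tensor_subcategory N C"
    and "simple_Q_system N C \<theta> w x M \<iota> v"
    and "P \<in> Hom N N \<theta> \<theta>" and "projection P"
  shows "let x2 = (x \<otimes>\<^bsub>\<theta>\<^esub> 1) * x in
         (\<exists>p \<in> Hom N N \<theta> \<theta>. projection p \<and>
            (1 \<otimes>\<^bsub>\<theta>\<^esub> p) * x = x * p \<and>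
            p * w = ((w\<^sup>\<dagger> * p) \<otimes>\<^bsub>\<theta>\<^esub> 1) * x * w \<and>
            P = assoc_proj \<theta> w x p * p)
     \<longleftrightarrow> (((w\<^sup>\<dagger> * P) \<otimes>\<^bsub>\<theta>\<^esub> 1) \<otimes>\<^bsub>compose N \<theta> \<theta>\<^esub> (w\<^sup>\<dagger> * P)) * x2 = P"
proof -
  have N: "von_neumann_algebra N" using assms(1) by (simp add: factor_def)
  interpret simple_frobenius N \<theta> w x
    using N assms(3,4) by (rule simple_Q_system_frobenius)
  have "\<theta> \<in> homs N N"
    using assms(3,4)
    by (auto simp: simple_Q_system_def Q_system_def Let_def full_tensor_subcategory_def End0_def)
  then have \<theta>1: "\<theta> 1 = 1" by (simp add: homs_def)
  \<comment> \<open>The extensional \<open>compose N \<theta> \<theta>\<close> is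
    \<open>undefined\<close> off \<open>N\<close>, so membership is needed to unfold it
    here.\<close>
  have "w\<^sup>\<dagger> * P \<in> N"
    using functional_counit[OF assms(5)] by (simp add: functional_def)
  then show ?thesis
    using product_of_slices_iff[OF assms(5,6)]
    by (simp add: hom_times_def assoc_proj_def compose_def \<theta>1)
qed

end
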